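(* The prime $2$ is Erdős-strong; that is, for every primitive set $A$ of even natural numbers, $$\sum_{a\in A}\frac{1}{a\log a}\le \frac{1}{2\log 2}.$$
   Context: A set $A\subset\mathbb{N}=\{1,2,\dots\}$ is primitive if no element of $A$ divides another distinct element of $A$. A prime $p$ is called Erdős-strong if $\sum_{a\in A}\frac{1}{a\log a}\le\frac{1}{p\log p}$ for every primitive set $A$ contained in the set of natural numbers whose least prime factor is $p$ (for $p=2$, this set is the set of even natural numbers). *)

theory Defs
  imports "HOL-Analysis.Analysis"
begin

definition primitive_set :: "nat set \<Rightarrow> bool" where
  "primitive_set A \<longleftrightarrow> (\<forall>a\<in>A. \<forall>b\<in>A. a dvd b \<longrightarrow> a = b)"

end

theory Submission
  imports Defs "HOL-Number_Theory.Prime_Powers"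
begin

text \<open>
  Write the even numbers as \<open>2 b\<close> and consider the random walk on positive integers that moves
  down from \<open>n\<close> to \<open>n / q\<close> with probability \<open>\<Lambda>(q) / log n\<close>. Each of its trajectories ends in 1 and
  meets a primitive set at most once, so \<open>\<Sum> v(b) \<le> v(1)\<close> over a primitive set for every \<open>v \<ge> 0\<close>
  with \<open>\<Sum>\<^sub>q v(m q) \<Lambda>(q) / log(m q) \<le> v(m)\<close>. For \<open>v(b) = 1 / (2 b log(2 b))\<close> this
  inequality reads \<open>\<Sum>\<^sub>q \<Lambda>(q) / (q log(m q) log(2 m q)) \<le> 1 / log(2 m)\<close>.
  Writing both sides as Laplace integrals (\<open>1 / c\<close> is the integral of \<open>exp(-c t)\<close>
  over \<open>t > 0\<close>), it follows from the pointwise inequality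
  \<open>- \<zeta>'(s) / \<zeta>(s) \<le> log 2 / (2 powr (s - 1) - 1)\<close> with \<open>s = 1 + t\<close>, which says precisely that the
  eta function \<open>(1 - 2 powr (1 - s)) \<zeta>(s)\<close> is increasing. The derivative of eta is the
  sum of \<open>(-1)^n log n / n powr s\<close>, which is nonnegative because it alternates with decreasing
  terms from \<open>n = 4\<close> on, and the terms up to \<open>n = 5\<close> have a nonnegative sum.
\<close>

section \<open>The logarithmic derivative of the zeta function\<close>

text \<open>Multiply by \<open>4 powr s\<close> and put \<open>y = (4/3) powr t\<close>. Bounding
  \<open>(4/5) powr t\<close> by 1 and \<open>2 powr t\<close> from below by
  \<open>y\<^sup>2\<close> leaves a quadratic inequality in \<open>y \<ge> 1\<close>.\<close>

lemma sum_ln_over_powr_2_to_5_nonneg: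
  fixes s :: real
  assumes "s \<ge> 1"
  shows "ln 3 / 3 powr s + ln 5 / 5 powr s \<le> ln 2 / 2 powr s + ln 4 / 4 powr s"
proof -
  define t where "t = s - 1"
  have t: "t \<ge> 0" and s: "s = 1 + t" using assms by (auto simp: t_def)
  define y where "y = (4/3 :: real) powr t"
  have y1: "y \<ge> 1" unfolding y_def using t by (simp add: ge_one_powr_ge_zero)
  have y2: "y\<^sup>2 \<le> 2 powr t"
  proof -
    have "y\<^sup>2 = (16/9) powr t"
      by (simp add: y_def power2_eq_square flip: powr_mult)
    also have "\<dots> \<le> 2 powr t" using t by (intro powr_mono2) auto
    finally show ?thesis .
  qed
  have z1: "(4/5) powr t \<le> (1::real)" using t by (intro powr_le1) auto
  have l3: "ln 3 \<le> 3 * ln (2::real)"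
    using ln_realpow[of 2 3] ln_le_cancel_iff[of "3::real" 8] by simp
  have l4: "ln 4 = 2 * ln (2::real)" using ln_realpow[of 2 2] by simp
  \<comment> \<open>This is 60 times the claim at \<open>s = 1\<close>; numerically it says that
    3^20 * 5^12 is at most 2^60.\<close>
  have base: "20 * ln 3 + 12 * ln 5 \<le> 60 * ln (2::real)"
  proof -
    have "20 * ln 3 = ln ((3::real) ^ 20)" "12 * ln 5 = ln ((5::real) ^ 12)"
      by (subst ln_realpow; simp)+
    then have "20 * ln 3 + 12 * ln 5 = ln ((3::real) ^ 20 * 5 ^ 12)"
      by (simp only: ln_mult_pos zero_less_power zero_less_numeral)
    also have "\<dots> \<le> ln (2 ^ 60)" by (subst ln_le_cancel_iff) auto
    also have "\<dots> = 60 * ln 2" by (subst ln_realpow) auto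
    finally show ?thesis .
  qed
  have "ln 3 * (4/3 * y) + ln 5 * (4/5 * (4/5) powr t) \<le> ln 3 * (4/3 * y) + ln 5 * (4/5)"
    using z1 by (intro add_left_mono mult_left_mono) auto
  also have "\<dots> \<le> 2 * ln 2 * y\<^sup>2 + 2 * ln 2"
  proof -
    \<comment> \<open>Expansion of the quadratic around \<open>y = 1\<close>: \<open>l3\<close>
      makes the linear coefficient nonnegative, and \<open>base\<close> handles the constant
      term.\<close>
    have "0 \<le> (y - 1) * (4 * ln 2 - 4/3 * ln 3) + 2 * ln 2 * (y - 1)\<^sup>2"
      using y1 l3 by (intro add_nonneg_nonneg mult_nonneg_nonneg) auto
    also have "\<dots> = 2 * ln 2 * y\<^sup>2 - 2 * ln 2 - ln 3 * (4/3 * y) + 4/3 * ln 3"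
      by (simp add: power2_eq_square field_simps)
    finally show ?thesis using base by linarith
  qed
  also have "\<dots> \<le> 2 * ln 2 * 2 powr t + 2 * ln 2"
    using y2 by (intro add_right_mono mult_left_mono) auto
  finally have *: "ln 3 * (4/3) powr s + ln 5 * (4/5) powr s \<le> ln 2 * 2 powr s + ln 4"
    by (simp add: s powr_add y_def l4 algebra_simps)
  have "ln 3 / 3 powr s + ln 5 / 5 powr s = (ln 3 * (4/3) powr s + ln 5 * (4/5) powr s) / 4 powr s"
    by (simp add: powr_divide field_simps)
  also have "\<dots> \<le> (ln 2 * 2 powr s + ln 4) / 4 powr s"
    using * by (intro divide_right_mono) auto
  also have "\<dots> = ln 2 / 2 powr s + ln 4 / 4 powr s"
  proof -
    have "(4::real) powr s = 2 powr s * 2 powr s"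
      by (simp flip: powr_mult)
    then show ?thesis by (simp add: add_divide_distrib)
  qed
  finally show ?thesis .
qed

text \<open>Both factors of (ln x / x) * (1 / x powr (s - 1)) decrease from x = e on.\<close>

lemma ln_over_powr_antimono:
  fixes x y s :: real
  assumes "exp 1 \<le> x" "x \<le> y" "s \<ge> 1"
  shows "ln y / y powr s \<le> ln x / x powr s"
proof -
  have "exp 1 \<ge> (1::real)" by simp
  then have x: "x > 0" "x \<ge> 1" using assms(1) by linarith+
  have split: "z powr s = z * z powr (s - 1)" if "z > 0" for z :: real
    using that by (simp add: powr_diff)
  have "ln y / y * (1 / y powr (s - 1)) \<le> ln x / x * (1 / x powr (s - 1))"
    using assms x ln_x_over_x_mono[of x y]
    by (intro mult_mono divide_left_mono powr_mono2) (auto intro!: divide_nonneg_nonneg)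
  then show ?thesis using x assms by (simp add: split)
qed

lemma alternating_sum_ln_over_powr_nonneg:
  fixes s :: real
  assumes "s \<ge> 1"
  shows "(\<Sum>n=1..2*M. (- 1) ^ n * (ln (real n) / real n powr s)) \<ge> 0"
proof -
  define f where "f = (\<lambda>n. ln (real n) / real n powr s)"
  have f_nonneg: "f n \<ge> 0" for n
    by (cases "n = 0") (auto simp: f_def)
  have f_anti: "f (Suc n) \<le> f n" if "n \<ge> 4" for n
    using that assms exp_le unfolding f_def by (intro ln_over_powr_antimono) auto
  have f5: "f 3 + f 5 \<le> f 2 + f 4"
    using sum_ln_over_powr_2_to_5_nonneg[OF assms] by (simp add: f_def)
  have step: "(\<Sum>n=1..2*Suc m. (- 1) ^ n * f n)
      = (\<Sum>n=1..2*m. (- 1) ^ n * f n) - f (Suc (2*m)) + f (2*Suc m)" for m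
    by simp
  \<comment> \<open>The last term is kept as a lower bound so that it can absorb the next, negative
    term in the induction.\<close>
  have *: "(\<Sum>n=1..2*(m+3). (- 1) ^ n * f n) \<ge> f (2*(m+3))" for m
  proof (induction m)
    case 0
    have "f 1 = 0" by (simp add: f_def)
    then show ?case using f5 by (simp add: eval_nat_numeral)
  next
    case (Suc m)
    have "f (Suc (2*(m+3))) \<le> f (2*(m+3))" by (rule f_anti) simp
    then show ?case using Suc.IH step[of "m+3"] unfolding add_Suc by linarith
  qed
  have f4: "f 3 \<le> f 2 + f 4"
    using f5 f_nonneg[of 5] by simp
  have "(\<Sum>n=1..2*M. (- 1) ^ n * f n) \<ge> 0"
  proof (cases "M \<ge> 3")
    case True
    then show ?thesis using *[of "M - 3"] f_nonneg[of "2 * M"] by simp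
  next
    case False
    then consider "M = 0" | "M = 1" | "M = 2" by linarith
    moreover have "f 1 = 0" by (simp add: f_def)
    ultimately show ?thesis
      using f_nonneg[of 2] f4 by cases (auto simp: eval_nat_numeral)
  qed
  then show ?thesis by (simp add: f_def)
qed

section \<open>Bounding the logarithmic derivative through truncated sums\<close>

text \<open>The alternating sum up to \<open>2*M\<close> is twice its even part minus the full sum,
  and ln (2 n) = ln 2 + ln n expresses the even part through the two sums up to
  \<open>M\<close>.\<close>

lemma sum_ln_over_powr_le:
  fixes s :: real
  assumes "s > 1"
  shows "(\<Sum>n=1..M. ln (real n) / real n powr s)
           \<le> ln 2 / (2 powr (s - 1) - 1) * (\<Sum>n=1..M. 1 / real n powr s)"
proof -
  define f where "f = (\<lambda>n. ln (real n) / real n powr s)"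
  define Z where "Z = (\<Sum>n=1..M. 1 / real n powr s)"
  define w where "w = (2::real) powr (s - 1)"
  have w: "w > 1" unfolding w_def using assms by simp
  have w2: "2 powr s = 2 * w" by (simp add: w_def powr_diff)
  have alt: "(\<Sum>n=1..2*m. (- 1) ^ n * f n) = 2 * (\<Sum>n=1..m. f (2*n)) - (\<Sum>n=1..2*m. f n)" for m
    by (induction m) auto
  have f2: "f (2*n) = (ln 2 * (1 / real n powr s) + f n) / (2 * w)" if "n \<in> {1..M}" for n
    using that by (simp add: f_def ln_mult powr_mult w2 add_divide_distrib mult_ac)
  have "(\<Sum>n=1..M. f n) \<le> (\<Sum>n=1..2*M. f n)"
    by (intro sum_mono2) (auto simp: f_def)
  also have "\<dots> \<le> 2 * (\<Sum>n=1..M. f (2*n))"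
    using alternating_sum_ln_over_powr_nonneg[of s M] alt[of M] assms by (simp add: f_def)
  also have "(\<Sum>n=1..M. f (2*n)) = (ln 2 * Z + (\<Sum>n=1..M. f n)) / (2 * w)"
    by (simp add: f2 Z_def sum_distrib_left flip: sum_divide_distrib sum.distrib)
  finally have "(w - 1) * (\<Sum>n=1..M. f n) \<le> ln 2 * Z"
    using w by (simp add: field_simps)
  then show ?thesis using w by (simp add: f_def Z_def w_def field_simps)
qed

text \<open>Since ln n is the sum of \<open>mangoldt\<close> over the divisors of n, the right side
  runs over all pairs (n, q) with q dividing n; the left side is the part with q at most
  \<open>K\<close> and n / q at most \<open>M\<close>.\<close>

lemma sum_mangoldt_mult_zeta_le:
  fixes s :: real
  shows "(\<Sum>q=1..K. mangoldt q / real q powr s) * (\<Sum>m=1..M. 1 / real m powr s)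
           \<le> (\<Sum>n=1..K*M. ln (real n) / real n powr s)"
proof -
  define g where "g = (\<lambda>(n, q). (mangoldt q :: real) / real n powr s)"
  have "(\<Sum>q=1..K. mangoldt q / real q powr s) * (\<Sum>m=1..M. 1 / real m powr s)
      = (\<Sum>(q, m)\<in>{1..K}\<times>{1..M}. g (q * m, q))"
    by (simp add: sum_product sum.cartesian_product g_def powr_mult)
  also have "\<dots> = sum g ((\<lambda>(q, m). (q * m, q)) ` ({1..K}\<times>{1..M}))"
    by (subst sum.reindex) (auto simp: inj_on_def case_prod_unfold)
  also have "\<dots> \<le> sum g (SIGMA n:{1..K*M}. {q. q dvd n})"
  proof (rule sum_mono2)
    show "finite (SIGMA n:{1..K*M}. {q. q dvd n})" by (intro finite_SigmaI) auto
    show "(\<lambda>(q, m). (q * m, q)) ` ({1..K}\<times>{1..M}) \<subseteq> (SIGMA n:{1..K*M}. {q. q dvd n})"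
      by (auto intro: mult_le_mono)
  qed (auto simp: g_def mangoldt_nonneg)
  also have "\<dots> = (\<Sum>n=1..K*M. \<Sum>q | q dvd n. g (n, q))"
    by (subst sum.Sigma) auto
  also have "\<dots> = (\<Sum>n=1..K*M. ln (real n) / real n powr s)"
    by (intro sum.cong refl) (simp add: g_def mangoldt_sum flip: sum_divide_distrib)
  finally show ?thesis .
qed

lemma sum_mangoldt_over_powr_le:
  fixes s :: real
  assumes "s > 1"
  shows "(\<Sum>q=1..K. mangoldt q / real q powr s) \<le> ln 2 / (2 powr (s - 1) - 1)"
proof (cases "K = 0")
  case True
  then show ?thesis using assms by (simp add: ge_one_powr_ge_zero)
next
  case False
  define D where "D = (\<Sum>q=1..K. mangoldt q / real q powr s)"
  define c where "c = ln 2 / ((2::real) powr (s - 1) - 1)"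
  define Z where "Z = (\<lambda>M. \<Sum>m=1..M. 1 / real m powr s)"
  define z where "z = (\<Sum>m. 1 / real (Suc m) powr s)"
  have "summable (\<lambda>m. real m powr - s)"
    using assms by (simp add: summable_real_powr_iff)
  then have sm: "summable (\<lambda>m. 1 / real (Suc m) powr s)"
    by (subst (asm) summable_Suc_iff [symmetric]) (simp add: powr_minus field_simps)
  have Z_eq: "Z M = (\<Sum>m<M. 1 / real (Suc m) powr s)" for M
    unfolding Z_def by (simp add: sum.atLeast1_atMost_eq)
  have lim: "Z \<longlonglongrightarrow> z"
    using summable_LIMSEQ[OF sm] by (simp add: Z_eq [abs_def] z_def)
  have z: "z > 0"
    unfolding z_def by (rule suminf_pos[OF sm]) simp
  have "D * Z M \<le> c * Z (K * M)" for M
    using sum_mangoldt_mult_zeta_le[where s = s and K = K and M = M] sum_ln_over_powr_le[OF assms, of "K * M"]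
    unfolding D_def c_def Z_def by linarith
  \<comment> \<open>Both truncations tend to the same positive zeta value, which then cancels. The
    subsequence requires \<open>K > 0\<close>, hence the separate case \<open>K = 0\<close>.\<close>
  moreover have "(\<lambda>M. Z (K * M)) \<longlonglongrightarrow> z"
    using lim False
    by (intro LIMSEQ_subseq_LIMSEQ[unfolded comp_def, of Z z "\<lambda>M. K * M"]) (auto simp: strict_mono_def)
  ultimately have "D * z \<le> c * z"
    by (intro LIMSEQ_le[OF tendsto_mult_left[OF lim] tendsto_mult_left]) auto
  then have "D \<le> c" using z by simp
  then show ?thesis by (simp add: D_def c_def)
qed

section \<open>Superharmonicity of the weight\<close>

lemma sum_mangoldt_laplace_kernel_le:
  fixes t :: real
  assumes "t \<ge> 0" "m \<ge> 1"
  shows "(\<Sum>q=2..K. mangoldt q / (real q * ln 2) *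
            (exp (- ln (real (m * q)) * t) - exp (- ln (real (2 * m * q)) * t)))
         \<le> exp (- ln (real (2 * m)) * t)"
proof (cases "t = 0")
  case True
  then show ?thesis by simp
next
  case False
  with assms have t: "t > 0" by simp
  define w where "w = (2::real) powr t"
  have w: "w > 1" using t by (simp add: w_def)
  have e: "exp (- ln (real n) * t) = 1 / real n powr t" if "n > 0" for n
    using that by (simp add: powr_def exp_minus field_simps)
  have "(\<Sum>q=2..K. mangoldt q / (real q * ln 2) *
            (exp (- ln (real (m * q)) * t) - exp (- ln (real (2 * m * q)) * t)))
      = (\<Sum>q=2..K. (1 - 1 / w) / (ln 2 * real m powr t) * (mangoldt q / real q powr (1 + t)))"
  proof (intro sum.cong refl, goal_cases)
    case (1 q)
    then have "q > 0" "m > 0" using assms by auto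
    then show ?case
      by (subst (1 2) e) (auto simp: powr_mult powr_add w_def field_simps)
  qed
  \<comment> \<open>The bound is tight enough because (1 - 1/w) / (w - 1) = 1/w, exactly the factor
    that turns \<open>m\<close> into \<open>2 * m\<close>.\<close>
  also have "\<dots> \<le> (1 - 1 / w) / (ln 2 * real m powr t) * (\<Sum>q=1..K. mangoldt q / real q powr (1 + t))"
    unfolding sum_distrib_left [symmetric] using w
    by (intro mult_left_mono sum_mono2) (auto simp: mangoldt_nonneg)
  also have "\<dots> \<le> (1 - 1 / w) / (ln 2 * real m powr t) * (ln 2 / (w - 1))"
    using sum_mangoldt_over_powr_le[of "1 + t" K] t w
    by (intro mult_left_mono) (simp_all flip: w_def)
  also have "\<dots> = 1 / real (2 * m) powr t"
    using w assms by (simp add: powr_mult divide_simps flip: w_def)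
  also have "\<dots> = exp (- ln (real (2 * m)) * t)"
    using assms by (subst e) auto
  finally show ?thesis .
qed

lemma sum_mangoldt_over_ln_mult_ln_le:
  assumes "m \<ge> (1::nat)"
  shows "(\<Sum>q=2..K. mangoldt q / (real q * ln (real (m * q)) * ln (real (2 * m * q))))
           \<le> 1 / ln (real (2 * m))"
proof -
  have lap: "((\<lambda>t. exp (- ln (real n) * t)) has_integral 1 / ln (real n)) {0..}" if "n \<ge> 2" for n
    using has_integral_exp_minus_to_infinity[of "ln (real n)" 0] that by simp
  have "((\<lambda>t. \<Sum>q=2..K. mangoldt q / (real q * ln 2) *
          (exp (- ln (real (m * q)) * t) - exp (- ln (real (2 * m * q)) * t)))
        has_integral
        (\<Sum>q=2..K. mangoldt q / (real q * ln 2) *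
          (1 / ln (real (m * q)) - 1 / ln (real (2 * m * q))))) {0..}"
  proof (intro has_integral_sum has_integral_mult_right has_integral_diff lap)
    fix q assume "q \<in> {2..K}"
    then show "m * q \<ge> 2" "2 * m * q \<ge> 2" using assms mult_le_mono[of 1 m 2 q] by auto
  qed auto
  moreover have "((\<lambda>t. exp (- ln (real (2 * m)) * t)) has_integral 1 / ln (real (2 * m))) {0..}"
    using assms by (intro lap) auto
  ultimately have "(\<Sum>q=2..K. mangoldt q / (real q * ln 2) *
          (1 / ln (real (m * q)) - 1 / ln (real (2 * m * q)))) \<le> 1 / ln (real (2 * m))"
    by (rule has_integral_le) (use sum_mangoldt_laplace_kernel_le assms in auto)
  also have "(\<Sum>q=2..K. mangoldt q / (real q * ln 2) *
          (1 / ln (real (m * q)) - 1 / ln (real (2 * m * q))))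
      = (\<Sum>q=2..K. mangoldt q / (real q * ln (real (m * q)) * ln (real (2 * m * q))))"
  proof (intro sum.cong refl, goal_cases)
    case (1 q)
    have pos: "m * q \<ge> 2" using 1 assms mult_le_mono[of 1 m 2 q] by auto
    define l where "l = ln (real (m * q))"
    have l: "l > 0" unfolding l_def using pos by (intro ln_gt_zero) linarith
    have l2: "ln (real (2 * m * q)) = ln 2 + l"
      using 1 assms by (simp add: l_def ln_mult mult.assoc)
    \<comment> \<open>This partial fraction is why the kernel is a difference of two exponentials
      divided by \<open>ln 2\<close>.\<close>
    have "1 / l - 1 / (ln 2 + l) = ln 2 / (l * (ln 2 + l))"
      using l ln_gt_zero[of "2::real"] by (simp add: diff_frac_eq add_pos_pos less_imp_neq[symmetric])
    then show ?case unfolding l2 l_def [symmetric] by simp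
  qed
  finally show ?thesis .
qed

section \<open>The downward random walk\<close>

text \<open>
  For \<open>B \<subseteq> {1..N}\<close>, this is the total mass passing through \<open>m\<close> if each \<open>b \<in> B\<close> receives the mass
  \<open>v b\<close> (and forgets what arrives from above) and all mass then moves down along the walk.
\<close>

function pushed_mass :: "nat set \<Rightarrow> nat \<Rightarrow> (nat \<Rightarrow> real) \<Rightarrow> nat \<Rightarrow> real" where
  "pushed_mass B N v m = (if m \<in> B then v m else
     (\<Sum>n\<in>{n \<in> {m<..N}. m dvd n}. mangoldt (n div m) / ln (real n) * pushed_mass B N v n))"
  by auto
termination
  by (relation "Wellfounded.measure (\<lambda>(B, N, v, m). N - m)") auto

declare pushed_mass.simps [simp del]

lemma sum_proper_multiples:
  assumes "m \<ge> (1::nat)"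
  shows "(\<Sum>n\<in>{n \<in> {m<..N}. m dvd n}. f n) = (\<Sum>q=2..N div m. f (m * q))"
proof (rule sum.reindex_bij_witness[of _ "\<lambda>q. m * q" "\<lambda>n. n div m"])
  fix n assume n: "n \<in> {n \<in> {m<..N}. m dvd n}"
  then obtain q where q: "n = m * q" by auto
  then show "m * (n div m) = n" "f (m * (n div m)) = f n" by auto
  show "n div m \<in> {2..N div m}"
    using n q assms by (cases "q = 0 \<or> q = 1") (auto simp: less_eq_div_iff_mult_less_eq mult.commute)
next
  fix q assume q: "q \<in> {2..N div m}"
  then show "m * q div m = q" using assms by simp
  show "m * q \<in> {n \<in> {m<..N}. m dvd n}"
    using q assms by (auto simp: less_eq_div_iff_mult_less_eq mult.commute)
qed

text \<open>Shows that the transition probabilities out of n > 1 add up to 1; the divisor n itself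
  would contribute mangoldt 1 = 0.\<close>

lemma sum_mangoldt_proper_divisors:
  assumes "n \<ge> (1::nat)"
  shows "(\<Sum>m | m dvd n \<and> m < n. mangoldt (n div m)) = ln (real n)"
proof -
  have "(\<Sum>m | m dvd n \<and> m < n. mangoldt (n div m)) = (\<Sum>m | m dvd n. mangoldt (n div m) :: real)"
  proof (rule sum.mono_neutral_left)
    show "\<forall>i\<in>{m. m dvd n} - {m. m dvd n \<and> m < n}. mangoldt (n div i) = (0::real)"
    proof
      fix i assume "i \<in> {m. m dvd n} - {m. m dvd n \<and> m < n}"
      then have "i = n" using dvd_imp_le[of i n] assms by auto
      then show "mangoldt (n div i) = (0::real)" using assms by simp
    qed
  qed (use assms in auto)
  also have "\<dots> = (\<Sum>d | d dvd n. mangoldt d)"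
    using assms by (intro sum.reindex_bij_witness[of _ "\<lambda>d. n div d" "\<lambda>d. n div d"]) auto
  finally show ?thesis using assms by (simp add: mangoldt_sum)
qed

text \<open>Induction from \<open>N\<close> downwards: replacing the mass at each proper multiple by
  the value of \<open>v\<close> there reduces the claim to \<open>super\<close>.\<close>

lemma pushed_mass_le:
  assumes "m \<ge> 1"
    and super: "\<And>m. m \<ge> 1 \<Longrightarrow> (\<Sum>q=2..N div m. mangoldt q / ln (real (m * q)) * v (m * q)) \<le> v m"
  shows "pushed_mass B N v m \<le> v m"
  using assms(1)
proof (induction "N - m" arbitrary: m rule: less_induct)
  case less
  show ?case
  proof (cases "m \<in> B")
    case True
    then show ?thesis by (simp add: pushed_mass.simps)
  next
    case False
    then have "pushed_mass B N v m =
        (\<Sum>n\<in>{n \<in> {m<..N}. m dvd n}. mangoldt (n div m) / ln (real n) * pushed_mass B N v n)"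
      by (simp add: pushed_mass.simps[of B N v m])
    also have "\<dots> \<le> (\<Sum>n\<in>{n \<in> {m<..N}. m dvd n}. mangoldt (n div m) / ln (real n) * v n)"
      using less by (intro sum_mono mult_left_mono) (auto simp: mangoldt_nonneg)
    also have "\<dots> = (\<Sum>q=2..N div m. mangoldt q / ln (real (m * q)) * v (m * q))"
      using less.prems by (subst sum_proper_multiples) auto
    also have "\<dots> \<le> v m" using super less.prems by simp
    finally show ?thesis .
  qed
qed

text \<open>Mass moves only to divisors: if \<open>m\<close> divides no element of \<open>B\<close>,
  neither does any multiple of \<open>m\<close>.\<close>

lemma pushed_mass_eq_0:
  assumes "\<not> (\<exists>b\<in>B. m dvd b)"
  shows "pushed_mass B N v m = 0"
  using assms
proof (induction "N - m" arbitrary: m rule: less_induct)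
  case less
  then have "pushed_mass B N v n = 0" if "n \<in> {n \<in> {m<..N}. m dvd n}" for n
    using that by (intro less.hyps) (auto intro: dvd_trans)
  then have "(\<Sum>n\<in>{n \<in> {m<..N}. m dvd n}. mangoldt (n div m) / ln (real n) * pushed_mass B N v n) = 0"
    by (intro sum.neutral) auto
  moreover have "m \<notin> B" using less.prems dvd_refl by blast
  ultimately show ?case by (subst pushed_mass.simps) simp
qed

text \<open>
  Mass is conserved: with \<open>L\<close> the set of divisors of elements of \<open>B\<close>, the walk leaves every
  \<open>n \<in> L\<close> with \<open>n \<noteq> 1\<close> and, as \<open>B\<close> is primitive, arrives in \<open>L - B\<close>.
\<close>

lemma pushed_mass_1:
  assumes "B \<subseteq> {1..N}" "primitive_set B" "B \<noteq> {}"
  shows "pushed_mass B N v 1 = (\<Sum>b\<in>B. v b)"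
proof -
  define T where "T = pushed_mass B N v"
  define L where "L = {m. \<exists>b\<in>B. m dvd b}"
  have LN: "L \<subseteq> {1..N}"
    using assms(1) by (force simp: L_def Suc_le_eq intro!: Nat.gr0I dest: dvd_imp_le)
  then have fin: "finite L" by (rule finite_subset) auto
  have BL: "B \<subseteq> L" unfolding L_def using dvd_refl by blast
  have one: "1 \<in> L" using assms(3) by (auto simp: L_def)
  have below: "m \<in> L - B" if "n \<in> L" "m dvd n" "m < n" for m n
  proof -
    obtain b where b: "b \<in> B" "n dvd b" using \<open>n \<in> L\<close> by (auto simp: L_def)
    then have "m dvd b" "n \<le> b"
      using that assms(1) by (auto intro: dvd_trans dvd_imp_le simp: subset_iff Suc_le_eq)
    moreover from this have "m \<noteq> b" using \<open>m < n\<close> by simp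
    ultimately show ?thesis
      using b assms(2) unfolding L_def primitive_set_def by blast
  qed
  have T_0: "T n = 0" if "n \<notin> L" for n
    using that pushed_mass_eq_0 by (simp add: T_def L_def)
  have T_step: "T m = (\<Sum>n | n \<in> L \<and> m < n \<and> m dvd n. mangoldt (n div m) / ln (real n) * T n)"
    if "m \<in> L - B" for m
  proof -
    have "T m = (\<Sum>n\<in>{n \<in> {m<..N}. m dvd n}. mangoldt (n div m) / ln (real n) * T n)"
      using that by (simp add: T_def pushed_mass.simps[of B N v m])
    also have "\<dots> = (\<Sum>n | n \<in> L \<and> m < n \<and> m dvd n. mangoldt (n div m) / ln (real n) * T n)"
      using LN T_0 by (intro sum.mono_neutral_right) auto
    finally show ?thesis .
  qed
  have "(\<Sum>m\<in>L - B. T m)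
      = (\<Sum>m\<in>L - B. \<Sum>n | n \<in> L \<and> m < n \<and> m dvd n. mangoldt (n div m) / ln (real n) * T n)"
    using T_step by (intro sum.cong) auto
  \<comment> \<open>Exchanging the sums regroups the arriving mass by the point n that it
    leaves.\<close>
  also have "\<dots> = (\<Sum>n\<in>L. \<Sum>m | m \<in> L - B \<and> m < n \<and> m dvd n. mangoldt (n div m) / ln (real n) * T n)"
    using fin by (intro sum.swap_restrict) auto
  also have "\<dots> = (\<Sum>n\<in>L. if n = 1 then 0 else T n)"
  proof (rule sum.cong)
    fix n assume n: "n \<in> L"
    then have n1: "n \<ge> 1" using LN by auto
    have "{m. m \<in> L - B \<and> m < n \<and> m dvd n} = {m. m dvd n \<and> m < n}"
      using below n by auto
    then have "(\<Sum>m | m \<in> L - B \<and> m < n \<and> m dvd n. mangoldt (n div m) / ln (real n) * T n)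
        = ln (real n) / ln (real n) * T n"
      using sum_mangoldt_proper_divisors[OF n1]
      by (simp flip: sum_distrib_right sum_divide_distrib)
    \<comment> \<open>At n = 1 the quotient is 0 / 0 = 0, so the walk stops there.\<close>
    also have "\<dots> = (if n = 1 then 0 else T n)" using n1 by auto
    finally show "(\<Sum>m | m \<in> L - B \<and> m < n \<and> m dvd n. mangoldt (n div m) / ln (real n) * T n)
        = (if n = 1 then 0 else T n)" .
  qed auto
  also have "\<dots> = (\<Sum>n\<in>L. T n) - T 1"
    using fin one by (simp add: sum.remove[of L 1])
  also have "(\<Sum>n\<in>L. T n) = (\<Sum>m\<in>L - B. T m) + (\<Sum>b\<in>B. T b)"
    using fin BL by (simp add: sum.subset_diff)
  finally have "T 1 = (\<Sum>b\<in>B. T b)" by simp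
  also have "\<dots> = (\<Sum>b\<in>B. v b)"
    by (intro sum.cong refl) (simp add: T_def pushed_mass.simps)
  finally show ?thesis by (simp add: T_def)
qed

text \<open>All the mass placed on \<open>B\<close> arrives at 1, where \<open>super\<close> limits
  it to \<open>v 1\<close>.\<close>

lemma primitive_set_sum_le:
  assumes "finite B" "0 \<notin> B" "primitive_set B" "v 1 \<ge> 0"
    and super: "\<And>m K. m \<ge> 1 \<Longrightarrow> (\<Sum>q=2..K. mangoldt q / ln (real (m * q)) * v (m * q)) \<le> v m"
  shows "(\<Sum>b\<in>B. v b) \<le> v 1"
proof (cases "B = {}")
  case True
  then show ?thesis using assms by simp
next
  case False
  have "b \<in> {1..Max B}" if "b \<in> B" for b
    using that assms by (cases b) auto
  then have "(\<Sum>b\<in>B. v b) = pushed_mass B (Max B) v 1"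
    using assms False by (intro pushed_mass_1 [symmetric]) auto
  also have "\<dots> \<le> v 1" using super by (intro pushed_mass_le) auto
  finally show ?thesis .
qed

section \<open>Application to even numbers\<close>

text \<open>Halving preserves primitivity, and \<open>v 1\<close> is the desired bound;
  \<open>super\<close> for \<open>v\<close> is the Laplace estimate divided by
  \<open>2 * m\<close>.\<close>

lemma finite_primitive_set_even_sum_le:
  assumes "finite F" "F \<subseteq> {n. n > 0 \<and> even n}" "primitive_set F"
  shows "(\<Sum>a\<in>F. 1 / (real a * ln (real a))) \<le> 1 / (2 * ln 2)"
proof -
  define B where "B = (\<lambda>a. a div 2) ` F"
  define v where "v = (\<lambda>b. 1 / (real (2 * b) * ln (real (2 * b))))"
  have FB: "F = (\<lambda>b. 2 * b) ` B"
    using assms(2) by (force simp: B_def image_image)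
  have "(\<Sum>a\<in>F. 1 / (real a * ln (real a))) = (\<Sum>b\<in>B. v b)"
    unfolding FB v_def by (subst sum.reindex) (auto simp: inj_on_def)
  also have "\<dots> \<le> v 1"
  proof (rule primitive_set_sum_le)
    show "finite B" using assms by (simp add: B_def)
    show "0 \<notin> B" using assms(2) by (auto simp: FB)
    show "primitive_set B" using assms(3) by (auto simp: FB primitive_set_def)
    show "v 1 \<ge> 0" by (simp add: v_def)
    fix m K :: nat assume m: "m \<ge> 1"
    have "(\<Sum>q=2..K. mangoldt q / ln (real (m * q)) * v (m * q))
        = 1 / real (2 * m) *
          (\<Sum>q=2..K. mangoldt q / (real q * ln (real (m * q)) * ln (real (2 * m * q))))"
      unfolding sum_distrib_left by (intro sum.cong) (auto simp: v_def mult_ac)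
    also have "\<dots> \<le> 1 / real (2 * m) * (1 / ln (real (2 * m)))"
      using sum_mangoldt_over_ln_mult_ln_le[OF m] by (intro mult_left_mono) auto
    also have "\<dots> = v m" by (simp add: v_def)
    finally show "(\<Sum>q=2..K. mangoldt q / ln (real (m * q)) * v (m * q)) \<le> v m" .
  qed
  finally show ?thesis by (simp add: v_def)
qed

theorem theorem1p4:
  fixes A :: "nat set"
  assumes "A \<subseteq> {n. n > 0 \<and> even n}"
    and "primitive_set A"
  shows "(\<lambda>a. 1 / (real a * ln (real a))) summable_on A \<and>
         (\<Sum>\<^sub>\<infinity>a\<in>A. 1 / (real a * ln (real a))) \<le> 1 / (2 * ln 2)"
proof -
  \<comment> \<open>As the terms are nonnegative, this uniform bound on finite subsums yields both
    summability and the bound on the infinite sum.\<close>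
  have le: "(\<Sum>a\<in>F. 1 / (real a * ln (real a))) \<le> 1 / (2 * ln 2)" if "finite F" "F \<subseteq> A" for F
    using that assms by (intro finite_primitive_set_even_sum_le) (auto simp: primitive_set_def)
  have "(\<lambda>a. 1 / (real a * ln (real a))) summable_on A"
  proof (rule nonneg_bdd_above_summable_on)
    fix a assume "a \<in> A"
    then have "a \<ge> 1" using assms(1) by auto
    then show "0 \<le> 1 / (real a * ln (real a))" by simp
  next
    show "bdd_above (sum (\<lambda>a. 1 / (real a * ln (real a))) ` {F. F \<subseteq> A \<and> finite F})"
      using le by (intro bdd_aboveI2[where M = "1 / (2 * ln 2)"]) auto
  qed
  then show ?thesis using infsum_le_finite_sums[OF _ le] by blast
qed

end
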